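(* Let $(V,E)$ and $(W,F)$ be lattice-normed spaces with $V$ decomposable and $F$ Dedekind complete. Then the exact dominant $\|T\|:E\to F$ of a dominated Uryson operator $T:V\to W$ can be calculated by the following formulas: (1) for $e\in\widetilde{E}_+$: $\ \|T\|(e)=\sup\Big\{\sum_{i=1}^n\|Tu_i\| : u_1,\dots,u_n\in V \text{ mutually disjoint},\ \sum_{i=1}^n\|u_i\|=e,\ n\in\mathbb{N}\Big\}$; (2) for $e\in E_+$: $\ \|T\|(e)=\sup\{\|T\|(e_0): e_0\in\widetilde{E}_+,\ e_0\sqsubseteq e\}$; (3) for $e\in E$: $\ \|T\|(e)=\|T\|(e_+)+\|T\|(e_-)$, where $e_+=e\vee 0$ and $e_-=(-e)\vee 0$.
   Context: Lattice-normed spaces. Let $V$ be a real vector space and $E$ a real Archimedean vector lattice. A vector norm is a map $\|\cdot\|:V\to E$ with $\|v\|\ge 0$, $\|v\|=0\Leftrightarrow v=0$, $\|v_1+v_2\|\le\|v_1\|+\|v_2\|$, $\|\lambda v\|=|\lambda|\,\|v\|$ ($\lambda\in\mathbb{R}$). $(V,E)$ is then a lattice-normed space. It is decomposable if whenever $\|x\|=e_1+e_2$ with $e_1,e_2\in E_+$ there are $x_1,x_2\in V$ with $x=x_1+x_2$ and $\|x_k\|=e_k$ ($k=1,2$). Elements $x,y\in V$ are disjoint, $x\perp y$, if $\|x\|\wedge\|y\|=0$. Abstract Uryson operators. In a vector lattice, $x\perp y$ means $|x|\wedge|y|=0$, and $y\sqsubseteq x$ means $y\perp(x-y)$. A map $S:E\to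 F$ between vector lattices is orthogonally additive if $S(x+y)=Sx+Sy$ whenever $x\perp y$; positive if $Sx\ge0$ for all $x\in E$; order bounded if it maps order bounded sets to order bounded sets; even if $S(x)=S(-x)$ for all $x$. An abstract Uryson operator is an orthogonally additive order bounded map. $\mathcal{U}_+^{ev}(E,F)$ is the set of positive even abstract Uryson operators, ordered by $S_1\le S_2$ iff $S_2-S_1$ is positive. Dominated Uryson operators. A map $T:V\to W$ is orthogonally additive if $T(u+v)=Tu+Tv$ whenever $u\perp v$ in $V$. It is a dominated Uryson operator if it is orthogonally additive and there is $S\in\mathcal{U}_+^{ev}(E,F)$ with $\|Tv\|\le S\|v\|$ for all $v\in V$; such an $S$ is called a dominant of $T$. The exact dominant $\|T\|$ is the least dominant of $T$ in $\mathcal{U}_+^{ev}(E,F)$; under the present hypotheses on $(V,E)$ and $(W,F)$ it exists. Notation: $\widetilde{E}_+$ is the set of all $e\in E_+$ of the form $e=\sum_{i=1}^n\|v_i\|$ with $n\in\mathbb{N}$ and $v_1,\dots,v_n\in V$ mutually disjoint. *)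

theory Defs
  imports "HOL-Analysis.Analysis" "HOL-Library.Lattice_Algebras" "HOL-Library.Lub_Glb"
begin

section \<open>Vector lattices\<close>

text \<open>The modulus is the one of \<^class>\<open>lattice_ab_group_add_abs\<close>,
  that is \<open>\<bar>x\<bar> = sup x (- x)\<close>.\<close>

class vector_lattice = ordered_real_vector + lattice_ab_group_add_abs

class archimedean_vector_lattice = vector_lattice +
  assumes archimedean: "(\<forall>n::nat. of_nat n *\<^sub>R x \<le> y) \<Longrightarrow> x \<le> 0"

definition disjoint_el :: "'e::vector_lattice \<Rightarrow> 'e \<Rightarrow> bool" where
  "disjoint_el x y \<longleftrightarrow> inf \<bar>x\<bar> \<bar>y\<bar> = 0"

definition fragment :: "'e::vector_lattice \<Rightarrow> 'e \<Rightarrow> bool" where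
  "fragment y x \<longleftrightarrow> disjoint_el y (x - y)"

definition order_bounded :: "'e::vector_lattice set \<Rightarrow> bool" where
  "order_bounded A \<longleftrightarrow> (\<exists>a b. A \<subseteq> {a..b})"


section \<open>Abstract Uryson operators\<close>

definition orth_additive :: "('e::vector_lattice \<Rightarrow> 'f::vector_lattice) \<Rightarrow> bool" where
  "orth_additive S \<longleftrightarrow> (\<forall>x y. disjoint_el x y \<longrightarrow> S (x + y) = S x + S y)"

text \<open>Positivity is required on all of \<open>E\<close>, not only on the positive cone.\<close>

definition positive_map :: "('e::vector_lattice \<Rightarrow> 'f::vector_lattice) \<Rightarrow> bool" where
  "positive_map S \<longleftrightarrow> (\<forall>x. 0 \<le> S x)"

definition even_map :: "('e::vector_lattice \<Rightarrow> 'f::vector_lattice) \<Rightarrow> bool" where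
  "even_map S \<longleftrightarrow> (\<forall>x. S x = S (- x))"

definition order_bounded_map :: "('e::vector_lattice \<Rightarrow> 'f::vector_lattice) \<Rightarrow> bool" where
  "order_bounded_map S \<longleftrightarrow> (\<forall>A. order_bounded A \<longrightarrow> order_bounded (S ` A))"

definition abstract_uryson :: "('e::vector_lattice \<Rightarrow> 'f::vector_lattice) \<Rightarrow> bool" where
  "abstract_uryson S \<longleftrightarrow> orth_additive S \<and> order_bounded_map S"

definition uryson_pos_even :: "('e::vector_lattice \<Rightarrow> 'f::vector_lattice) set" where
  "uryson_pos_even = {S. abstract_uryson S \<and> positive_map S \<and> even_map S}"

definition uryson_le ::
    "('e::vector_lattice \<Rightarrow> 'f::vector_lattice) \<Rightarrow> ('e \<Rightarrow> 'f) \<Rightarrow> bool" where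
  "uryson_le S1 S2 \<longleftrightarrow> positive_map (\<lambda>x. S2 x - S1 x)"


section \<open>Lattice-normed spaces\<close>

definition lattice_normed_space ::
    "('v::real_vector \<Rightarrow> 'e::archimedean_vector_lattice) \<Rightarrow> bool" where
  "lattice_normed_space vn \<longleftrightarrow>
     (\<forall>v. 0 \<le> vn v) \<and>
     (\<forall>v. vn v = 0 \<longleftrightarrow> v = 0) \<and>
     (\<forall>v1 v2. vn (v1 + v2) \<le> vn v1 + vn v2) \<and>
     (\<forall>c v. vn (c *\<^sub>R v) = \<bar>c\<bar> *\<^sub>R vn v)"

definition decomposable ::
    "('v::real_vector \<Rightarrow> 'e::archimedean_vector_lattice) \<Rightarrow> bool" where
  "decomposable vn \<longleftrightarrow>
     (\<forall>x e1 e2. 0 \<le> e1 \<and> 0 \<le> e2 \<and> vn x = e1 + e2 \<longrightarrow>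
        (\<exists>x1 x2. x = x1 + x2 \<and> vn x1 = e1 \<and> vn x2 = e2))"

definition disjoint_vec ::
    "('v::real_vector \<Rightarrow> 'e::archimedean_vector_lattice) \<Rightarrow> 'v \<Rightarrow> 'v \<Rightarrow> bool" where
  "disjoint_vec vn x y \<longleftrightarrow> inf (vn x) (vn y) = 0"

text \<open>Disjointness is required for distinct indices, so an element that is repeated
  in the family must be disjoint from itself.\<close>

definition mutually_disjoint ::
    "('v::real_vector \<Rightarrow> 'e::archimedean_vector_lattice) \<Rightarrow> nat \<Rightarrow> (nat \<Rightarrow> 'v) \<Rightarrow> bool" where
  "mutually_disjoint vn n v \<longleftrightarrow> pairwise (\<lambda>i j. disjoint_vec vn (v i) (v j)) {1..n}"

definition E_tilde_pos ::
    "('v::real_vector \<Rightarrow> 'e::archimedean_vector_lattice) \<Rightarrow> 'e set" where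
  "E_tilde_pos vn =
     {e. 0 \<le> e \<and> (\<exists>n v. mutually_disjoint vn n v \<and> e = (\<Sum>i=1..n. vn (v i)))}"


section \<open>Dominated Uryson operators\<close>

definition orth_additive_vec ::
    "('v::real_vector \<Rightarrow> 'e::archimedean_vector_lattice) \<Rightarrow> ('v \<Rightarrow> 'w::real_vector) \<Rightarrow> bool" where
  "orth_additive_vec vn T \<longleftrightarrow> (\<forall>u v. disjoint_vec vn u v \<longrightarrow> T (u + v) = T u + T v)"

definition dominant ::
    "('v::real_vector \<Rightarrow> 'e::archimedean_vector_lattice) \<Rightarrow>
     ('w::real_vector \<Rightarrow> 'f::archimedean_vector_lattice) \<Rightarrow> ('v \<Rightarrow> 'w) \<Rightarrow> ('e \<Rightarrow> 'f) \<Rightarrow> bool" where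
  "dominant vn wn T S \<longleftrightarrow> S \<in> uryson_pos_even \<and> (\<forall>v. wn (T v) \<le> S (vn v))"

definition dominated_uryson ::
    "('v::real_vector \<Rightarrow> 'e::archimedean_vector_lattice) \<Rightarrow>
     ('w::real_vector \<Rightarrow> 'f::archimedean_vector_lattice) \<Rightarrow> ('v \<Rightarrow> 'w) \<Rightarrow> bool" where
  "dominated_uryson vn wn T \<longleftrightarrow> orth_additive_vec vn T \<and> (\<exists>S. dominant vn wn T S)"

definition is_exact_dominant ::
    "('v::real_vector \<Rightarrow> 'e::archimedean_vector_lattice) \<Rightarrow>
     ('w::real_vector \<Rightarrow> 'f::archimedean_vector_lattice) \<Rightarrow> ('v \<Rightarrow> 'w) \<Rightarrow> ('e \<Rightarrow> 'f) \<Rightarrow> bool" where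
  "is_exact_dominant vn wn T S \<longleftrightarrow>
     dominant vn wn T S \<and> (\<forall>S'. dominant vn wn T S' \<longrightarrow> uryson_le S S')"

definition exact_dominant ::
    "('v::real_vector \<Rightarrow> 'e::archimedean_vector_lattice) \<Rightarrow>
     ('w::real_vector \<Rightarrow> 'f::archimedean_vector_lattice) \<Rightarrow> ('v \<Rightarrow> 'w) \<Rightarrow> 'e \<Rightarrow> 'f" where
  "exact_dominant vn wn T = (THE S. is_exact_dominant vn wn T S)"

end

theory Submission
  imports Defs
begin

text \<open>
  The exact dominant is constructed rather than assumed. For a fragment \<open>g\<close> of \<open>e \<ge> 0\<close>, consider
  all disjoint families \<open>u\<close> in \<open>V\<close> whose norms add up to \<open>g\<close>, and let \<open>fragment_sup e\<close> be the
  supremum of the sums \<open>\<Sum>i. \<parallel>T (u i)\<parallel>\<close> over all such families and all fragments \<open>g\<close> of \<open>e\<close>. An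
  arbitrary \<open>e\<close> receives the sum of the values at its positive and negative parts; this is
  \<open>maximal_variation\<close>.

  A dominant \<open>S\<close> is additive on disjoint elements, so it bounds each of these sums by \<open>S g\<close>; being
  positive, it satisfies \<open>S g \<le> S e\<close>, and being even, it splits over positive and
  negative part. Hence \<open>maximal_variation\<close> lies below every dominant, which makes the suprema exist
  and yields order boundedness. A one-element family shows that \<open>maximal_variation\<close>
  satisfies the inequality required of a dominant.

  The substance is orthogonal additivity. For disjoint positive \<open>a\<close> and \<open>b\<close>, families over fragments
  of \<open>a\<close> and of \<open>b\<close> can be concatenated (\<open>family_sums_add\<close>). Conversely, decomposability cuts
  every member of a family over a fragment of \<open>a + b\<close> into a part of norm below \<open>a\<close> and a part of
  norm below \<open>b\<close>; the two resulting norm sums are again fragments of \<open>a\<close> and \<open>b\<close>, and the triangle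
  inequality shows that the sum of norms does not drop (\<open>family_sums_split\<close>).

  The formulas then follow. If \<open>e\<close> itself is the norm sum of a disjoint family, cutting such a
  family along a fragment \<open>g\<close> of \<open>e\<close> provides a family over \<open>e - g\<close>, so that a family over \<open>g\<close>
  extends to one over \<open>e\<close> (\<open>family_sums_extend\<close>) and proper fragments add nothing to the supremum.
  For general \<open>e \<ge> 0\<close>, each sum over a fragment \<open>g\<close> is below the value at \<open>g\<close>, which is
  below the value at \<open>e\<close>.
\<close>

section \<open>Disjointness in vector lattices\<close>

lemma disjoint_el_sym: "disjoint_el x y \<Longrightarrow> disjoint_el y x"
  by (simp add: disjoint_el_def inf_commute)

lemma disjoint_el_zero [simp]: "disjoint_el 0 x" "disjoint_el x 0"
  by (simp_all add: disjoint_el_def inf_absorb1 inf_absorb2)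

lemma disjoint_el_minus [simp]: "disjoint_el x (- y) \<longleftrightarrow> disjoint_el x y"
  by (simp add: disjoint_el_def)

lemma disjoint_el_nonneg_iff:
  "0 \<le> x \<Longrightarrow> 0 \<le> y \<Longrightarrow> disjoint_el x y \<longleftrightarrow> inf x y = 0"
  by (simp add: disjoint_el_def)

lemma disjoint_el_mono:
  assumes "disjoint_el x y" "\<bar>x'\<bar> \<le> \<bar>x\<bar>"
  shows "disjoint_el x' y"
proof -
  have "inf \<bar>x'\<bar> \<bar>y\<bar> \<le> inf \<bar>x\<bar> \<bar>y\<bar>"
    using assms(2) by (intro inf_mono) auto
  also have "\<dots> = 0" using assms(1) by (simp add: disjoint_el_def)
  finally show ?thesis by (simp add: disjoint_el_def antisym)
qed

lemma disjoint_el_mono_nonneg: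
  assumes "disjoint_el x y" "0 \<le> x'" "x' \<le> x" "0 \<le> y'" "y' \<le> y"
  shows "disjoint_el x' y'"
proof -
  have "\<bar>x'\<bar> \<le> \<bar>x\<bar>" "\<bar>y'\<bar> \<le> \<bar>y\<bar>"
    using assms order_trans [OF assms(2,3)] order_trans [OF assms(4,5)] by simp_all
  then show ?thesis using assms(1) by (meson disjoint_el_mono disjoint_el_sym)
qed

text \<open>Subtracting \<open>z\<close> shows that \<open>inf x (y + z)\<close> is below \<open>inf x y + z\<close>; it is also below
  \<open>inf x y + x\<close>. The infimum of these two bounds is the right-hand side.\<close>

lemma inf_add_le:
  fixes x y z :: "'e::vector_lattice"
  assumes "0 \<le> x" "0 \<le> y" "0 \<le> z"
  shows "inf x (y + z) \<le> inf x y + inf x z"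
proof -
  let ?w = "inf x (y + z)"
  have "?w - z \<le> y" by (simp add: diff_le_eq)
  moreover have "?w - z \<le> x"
    using assms(3) by (simp add: diff_le_eq add_increasing2)
  ultimately have "?w \<le> inf x y + z" by (simp add: diff_le_eq [symmetric])
  moreover have "?w \<le> inf x y + x"
    using assms(1,2) by (simp add: add_increasing le_infI1)
  ultimately have "?w \<le> inf (inf x y + x) (inf x y + z)" by simp
  then show ?thesis by (simp only: add_inf_distrib_left)
qed

lemma disjoint_el_add:
  assumes "disjoint_el x y" "disjoint_el x z"
  shows "disjoint_el x (y + z)"
proof -
  have "inf \<bar>x\<bar> \<bar>y + z\<bar> \<le> inf \<bar>x\<bar> (\<bar>y\<bar> + \<bar>z\<bar>)"
    by (intro inf_mono order_refl abs_triangle_ineq)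
  also have "\<dots> \<le> inf \<bar>x\<bar> \<bar>y\<bar> + inf \<bar>x\<bar> \<bar>z\<bar>"
    by (intro inf_add_le) auto
  also have "\<dots> = 0" using assms by (simp add: disjoint_el_def)
  finally show ?thesis by (simp add: disjoint_el_def antisym)
qed

lemma disjoint_el_diff:
  "disjoint_el x y \<Longrightarrow> disjoint_el x z \<Longrightarrow> disjoint_el x (y - z)"
  using disjoint_el_add [of x y "- z"] by simp

lemma disjoint_el_sum:
  "(\<And>i. i \<in> I \<Longrightarrow> disjoint_el x (f i)) \<Longrightarrow> disjoint_el x (sum f I)"
  by (induction I rule: infinite_finite_induct) (auto intro: disjoint_el_add)

lemma pos_diff_neg: "sup e 0 - sup (- e) 0 = (e::'e::vector_lattice)"
  using prts [of e] by (simp add: pprt_def nprt_def neg_inf_eq_sup sup_commute inf_commute)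

lemma disjoint_el_pos_neg: "disjoint_el (sup e 0) (sup (- e) 0)"
proof -
  have eq: "sup e 0 = e + sup (- e) 0" using pos_diff_neg [of e] by (simp only: diff_eq_eq)
  have "inf (sup e 0) (sup (- e) 0) = inf (e + sup (- e) 0) (0 + sup (- e) 0)"
    using eq by simp
  also have "\<dots> = inf e 0 + sup (- e) 0" by (simp only: add_inf_distrib_right)
  also have "\<dots> = 0" using neg_inf_eq_sup [of e 0] by (metis add.right_inverse neg_0_equal_iff_equal)
  finally show ?thesis by (subst disjoint_el_nonneg_iff) simp_all
qed

text \<open>A representation as a difference of two disjoint positive elements is unique,
  because \<open>p + n = sup p n\<close> for disjoint \<open>p\<close> and \<open>n\<close>.\<close>

lemma pos_of_disjoint_diff:
  fixes p n :: "'e::vector_lattice"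
  assumes "0 \<le> p" "0 \<le> n" "disjoint_el p n"
  shows "sup (p - n) 0 = p"
proof -
  have "sup p n = p + n"
    using add_eq_inf_sup [of p n] assms by (simp add: disjoint_el_nonneg_iff)
  moreover have "sup (p - n) 0 + n = sup p n" by (simp add: add_sup_distrib_right)
  ultimately show ?thesis by simp
qed

text \<open>The differences of the parts of \<open>x\<close> and \<open>y\<close> add up to \<open>x + y\<close>, and each
  positive part is disjoint from each negative part, so \<open>pos_of_disjoint_diff\<close> applies.\<close>

lemma pos_add_disjoint:
  fixes x y :: "'e::vector_lattice"
  assumes "disjoint_el x y"
  shows "sup (x + y) 0 = sup x 0 + sup y 0"
    and "disjoint_el (sup x 0) (sup y 0)"
proof -
  have le: "\<bar>sup z 0\<bar> \<le> \<bar>z\<bar>" "\<bar>sup (- z) 0\<bar> \<le> \<bar>z\<bar>" for z :: 'e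
    by (simp_all add: abs_ge_self abs_ge_minus_self)
  have xy: "disjoint_el a b" if "\<bar>a\<bar> \<le> \<bar>x\<bar>" "\<bar>b\<bar> \<le> \<bar>y\<bar>" for a b
    using assms that by (meson disjoint_el_mono disjoint_el_sym)
  show "disjoint_el (sup x 0) (sup y 0)" by (intro xy le)
  have "disjoint_el (sup x 0 + sup y 0) (sup (- x) 0 + sup (- y) 0)"
    by (intro disjoint_el_add disjoint_el_sym [OF disjoint_el_add]
        disjoint_el_sym [OF disjoint_el_pos_neg] disjoint_el_pos_neg xy
        disjoint_el_sym [OF xy] le)
  then have "sup ((sup x 0 + sup y 0) - (sup (- x) 0 + sup (- y) 0)) 0 = sup x 0 + sup y 0"
    by (intro pos_of_disjoint_diff) simp_all
  moreover have "(sup x 0 + sup y 0) - (sup (- x) 0 + sup (- y) 0) = x + y"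
    using pos_diff_neg [of x] pos_diff_neg [of y] by (metis add_diff_add)
  ultimately show "sup (x + y) 0 = sup x 0 + sup y 0" by simp
qed

text \<open>The two pieces are disjoint, so their sum is their supremum, hence at most \<open>x\<close>;
  subadditivity of \<open>inf x\<close> gives the other inequality.\<close>

lemma disjoint_split:
  fixes x a b :: "'e::vector_lattice"
  assumes "0 \<le> x" "0 \<le> a" "0 \<le> b" "disjoint_el a b" "x \<le> a + b"
  shows "x = inf x a + inf x b" "disjoint_el (inf x a) (inf x b)"
proof -
  have "inf a b = 0" using assms by (simp add: disjoint_el_nonneg_iff)
  then have "inf (inf x a) (inf x b) \<le> 0" by (metis inf_le2 inf_mono)
  then have 0: "inf (inf x a) (inf x b) = 0" using assms by (simp add: antisym)
  then show "disjoint_el (inf x a) (inf x b)"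
    using assms by (simp add: disjoint_el_nonneg_iff)
  have "inf x a + inf x b = sup (inf x a) (inf x b)"
    using add_eq_inf_sup [of "inf x a" "inf x b"] 0 by simp
  then have "inf x a + inf x b \<le> x" by simp
  moreover have "x \<le> inf x a + inf x b"
    using inf_add_le [of x a b] assms by (simp add: inf_absorb1)
  ultimately show "x = inf x a + inf x b" by simp
qed

text \<open>The negative part of \<open>e - g\<close> is below both \<open>g\<close> and \<open>\<bar>e - g\<bar>\<close>, which are disjoint.\<close>

lemma fragment_le:
  assumes "fragment g e" "0 \<le> g" "0 \<le> e"
  shows "g \<le> e"
proof -
  have "sup (- (e - g)) 0 \<le> inf \<bar>g\<bar> \<bar>e - g\<bar>"
    using assms(2,3) abs_ge_minus_self [of "e - g"] by simp
  also have "\<dots> = 0" using assms(1) by (simp add: fragment_def disjoint_el_def)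
  finally show ?thesis by simp
qed

lemma fragment_refl [simp]: "fragment e e"
  by (simp add: fragment_def)

lemma fragment_add:
  assumes "fragment g a" "fragment h b" "0 \<le> g" "0 \<le> h" "0 \<le> a" "0 \<le> b" "disjoint_el a b"
  shows "fragment (g + h) (a + b)"
proof -
  have le: "g \<le> a" "h \<le> b" using assms by (auto intro: fragment_le)
  note ab = disjoint_el_mono_nonneg [OF assms(7)]
  have "disjoint_el (g + h) ((a - g) + (b - h))"
    using assms le unfolding fragment_def
    by (intro disjoint_el_add disjoint_el_sym [OF disjoint_el_add])
      (auto intro: ab disjoint_el_sym [OF ab] disjoint_el_sym)
  then show ?thesis by (simp add: fragment_def algebra_simps)
qed


section \<open>Positive even Uryson operators\<close>

lemma orth_additive_zero: "orth_additive S \<Longrightarrow> S 0 = 0"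
  unfolding orth_additive_def by (metis add_0 add_cancel_right_left disjoint_el_zero(1))

lemma uryson_add:
  "S \<in> uryson_pos_even \<Longrightarrow> disjoint_el x y \<Longrightarrow> S (x + y) = S x + S y"
  by (simp add: uryson_pos_even_def abstract_uryson_def orth_additive_def)

lemma uryson_fragment_le:
  assumes "S \<in> uryson_pos_even" "fragment g e"
  shows "S g \<le> S e"
proof -
  have "S (g + (e - g)) = S g + S (e - g)"
    using assms by (intro uryson_add) (simp_all add: fragment_def)
  moreover have "0 \<le> S (e - g)"
    using assms by (simp add: uryson_pos_even_def positive_map_def)
  ultimately show ?thesis by simp
qed

text \<open>Both \<open>e\<^sub>+\<close> and \<open>- e\<^sub>-\<close> are disjoint summands of \<open>e\<close>, and evenness removes the sign.\<close>

lemma uryson_pos_neg: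
  assumes "S \<in> uryson_pos_even"
  shows "S e = S (sup e 0) + S (sup (- e) 0)"
proof -
  have "S (sup e 0 + - sup (- e) 0) = S (sup e 0) + S (- sup (- e) 0)"
    using disjoint_el_pos_neg [of e] by (intro uryson_add [OF assms]) (simp only: disjoint_el_minus)
  moreover have "S (- sup (- e) 0) = S (sup (- e) 0)"
    using assms unfolding uryson_pos_even_def even_map_def by (metis (mono_tags) mem_Collect_eq)
  moreover have "sup e 0 + - sup (- e) 0 = e"
    using pos_diff_neg [of e] by (simp only: diff_conv_add_uminus)
  ultimately show ?thesis by metis
qed


section \<open>Disjoint families in a lattice-normed space\<close>

lemma mutually_disjoint_Suc:
  "mutually_disjoint vn (Suc n) u \<longleftrightarrow>
     mutually_disjoint vn n u \<and> (\<forall>i\<in>{1..n}. disjoint_vec vn (u (Suc n)) (u i))"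
  by (auto simp: mutually_disjoint_def atLeastAtMostSuc_conv pairwise_insert
      disjoint_vec_def inf_commute)

locale dominated_operator =
  fixes vn :: "'v::real_vector \<Rightarrow> 'e::archimedean_vector_lattice"
    and wn :: "'w::real_vector \<Rightarrow> 'f::{archimedean_vector_lattice, conditionally_complete_lattice}"
    and T :: "'v \<Rightarrow> 'w"
  assumes vn: "lattice_normed_space vn"
    and wn: "lattice_normed_space wn"
    and decomposable: "decomposable vn"
    and dominated: "dominated_uryson vn wn T"
begin

lemma vn_nonneg [simp]: "0 \<le> vn v"
  using vn by (simp add: lattice_normed_space_def)

lemma vn_eq_0_iff [simp]: "vn v = 0 \<longleftrightarrow> v = 0"
  using vn by (simp add: lattice_normed_space_def)

lemma wn_nonneg [simp]: "0 \<le> wn w"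
  using wn by (simp add: lattice_normed_space_def)

lemma wn_triangle: "wn (x + y) \<le> wn x + wn y"
  using wn by (simp add: lattice_normed_space_def)

lemma sum_vn_nonneg [simp]: "0 \<le> (\<Sum>i\<in>I. vn (u i))"
  by (simp add: sum_nonneg)

lemma disjoint_vec_iff: "disjoint_vec vn x y \<longleftrightarrow> disjoint_el (vn x) (vn y)"
  by (simp add: disjoint_vec_def disjoint_el_nonneg_iff)

definition family_sums :: "'e \<Rightarrow> 'f set" where
  "family_sums g =
     {(\<Sum>i=1..n. wn (T (u i))) | n u. mutually_disjoint vn n u \<and> (\<Sum>i=1..n. vn (u i)) = g}"

lemma family_sumsI:
  "mutually_disjoint vn n u \<Longrightarrow>
     (\<Sum>i=1..n. wn (T (u i))) \<in> family_sums (\<Sum>i=1..n. vn (u i))"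
  unfolding family_sums_def by blast

lemma family_sums_nonempty: "g \<in> E_tilde_pos vn \<Longrightarrow> family_sums g \<noteq> {}"
  unfolding E_tilde_pos_def family_sums_def by blast

lemma family_sums_E_tilde: "s \<in> family_sums g \<Longrightarrow> g \<in> E_tilde_pos vn"
  unfolding E_tilde_pos_def family_sums_def by auto

lemma family_sums_base_nonneg: "s \<in> family_sums g \<Longrightarrow> 0 \<le> g"
  unfolding family_sums_def by auto

lemma family_sums_nonneg: "s \<in> family_sums g \<Longrightarrow> 0 \<le> s"
  unfolding family_sums_def by (auto intro!: sum_nonneg)

lemma family_sums_zero: "0 \<in> family_sums 0"
  unfolding family_sums_def
  by (rule CollectI, rule exI [of _ 0]) (simp add: mutually_disjoint_def)

lemma family_sums_norm: "wn (T v) \<in> family_sums (vn v)"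
  unfolding family_sums_def
  by (rule CollectI, rule exI [of _ 1], rule exI [of _ "\<lambda>_. v"])
    (simp add: mutually_disjoint_def pairwise_def)

lemma vn_le_family_sum:
  fixes u :: "nat \<Rightarrow> 'v"
  assumes "i \<in> {1..n}"
  shows "vn (u i) \<le> (\<Sum>i=1..n. vn (u i))"
proof -
  have "(\<Sum>i=1..n. vn (u i)) = vn (u i) + (\<Sum>i\<in>{1..n} - {i}. vn (u i))"
    using assms by (intro sum.remove) simp_all
  then show ?thesis using sum_vn_nonneg [of u "{1..n} - {i}"] by simp
qed

text \<open>Members of the two families lie below \<open>g\<close> and \<open>h\<close> respectively, so the concatenated
  family is again disjoint.\<close>

lemma family_sums_add:
  assumes s: "s \<in> family_sums g" and t: "t \<in> family_sums h" and gh: "disjoint_el g h"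
  shows "s + t \<in> family_sums (g + h)"
proof -
  obtain n u where u: "mutually_disjoint vn n u" "(\<Sum>i=1..n. vn (u i)) = g"
      "s = (\<Sum>i=1..n. wn (T (u i)))"
    using s unfolding family_sums_def by blast
  obtain m v where v: "mutually_disjoint vn m v" "(\<Sum>i=1..m. vn (v i)) = h"
      "t = (\<Sum>i=1..m. wn (T (v i)))"
    using t unfolding family_sums_def by blast
  \<comment> \<open>Families are indexed from 1, so the second one is shifted by \<open>n\<close>.\<close>
  define w where "w i = (if i \<le> n then u i else v (i - n))" for i
  have sums: "(\<Sum>i=1..n+m. f (w i)) = (\<Sum>i=1..n. f (u i)) + (\<Sum>i=1..m. f (v i))"
    for f :: "'v \<Rightarrow> 'x::comm_monoid_add"
  proof -
    have "(\<Sum>i=1..n+m. f (w i)) = (\<Sum>i=1..n. f (w i)) + (\<Sum>i=n+1..n+m. f (w i))"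
      by (rule sum.ub_add_nat) simp
    also have "(\<Sum>i=n+1..n+m. f (w i)) = (\<Sum>i=1..m. f (w (i + n)))"
      using sum.shift_bounds_cl_nat_ivl [of "\<lambda>i. f (w i)" 1 n m] by (simp add: add.commute)
    finally show ?thesis by (simp add: w_def)
  qed
  have uv: "disjoint_vec vn (u i) (v j)" if "i \<in> {1..n}" "j \<in> {1..m}" for i j
  proof -
    have "vn (u i) \<le> g" "vn (v j) \<le> h"
      using vn_le_family_sum [OF that(1), of u] vn_le_family_sum [OF that(2), of v] u v by simp_all
    then show ?thesis
      unfolding disjoint_vec_iff by (intro disjoint_el_mono_nonneg [OF gh] vn_nonneg)
  qed
  have "disjoint_vec vn (w i) (w j)" if ij: "i \<in> {1..n+m}" "j \<in> {1..n+m}" "i \<noteq> j" for i j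
  proof -
    consider "i \<le> n" "j \<le> n" | "i \<le> n" "n < j" | "n < i" "j \<le> n" | "n < i" "n < j"
      by linarith
    then show ?thesis
    proof cases
      case 1
      then show ?thesis using u(1) ij by (simp add: mutually_disjoint_def pairwise_def w_def)
    next
      case 2
      then have "i \<in> {1..n}" "j - n \<in> {1..m}" using ij by auto
      then show ?thesis using uv 2 by (simp add: w_def)
    next
      case 3
      then have "j \<in> {1..n}" "i - n \<in> {1..m}" using ij by auto
      then show ?thesis using uv 3 by (simp add: w_def disjoint_vec_def inf_commute)
    next
      case 4
      then have "i - n \<in> {1..m}" "j - n \<in> {1..m}" "i - n \<noteq> j - n" using ij by auto
      then show ?thesis using v(1) 4 by (simp add: mutually_disjoint_def pairwise_def w_def)
    qed
  qed
  then have "mutually_disjoint vn (n + m) w"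
    by (simp add: mutually_disjoint_def pairwise_def)
  note family_sumsI [OF this]
  moreover have "(\<Sum>i=1..n+m. vn (w i)) = g + h" using sums [of vn] u v by simp
  moreover have "(\<Sum>i=1..n+m. wn (T (w i))) = s + t"
    using sums [of "\<lambda>x. wn (T x)"] u v by simp
  ultimately show ?thesis by simp
qed

text \<open>The place where decomposability enters: by \<open>disjoint_split\<close> the norm of each member is the
  sum of its infima with \<open>a\<close> and with \<open>b\<close>, so the member itself can be cut into two disjoint
  vectors with these norms, over which \<open>T\<close> is additive.\<close>

lemma family_sums_split:
  assumes s: "s \<in> family_sums g" and gab: "fragment g (a + b)"
    and ab: "0 \<le> a" "0 \<le> b" "disjoint_el a b"
  obtains g1 g2 s1 s2 where "fragment g1 a" "fragment g2 b" "g = g1 + g2"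
    "s1 \<in> family_sums g1" "s2 \<in> family_sums g2" "s \<le> s1 + s2"
proof -
  obtain n u where u: "mutually_disjoint vn n u" "(\<Sum>i=1..n. vn (u i)) = g"
      "s = (\<Sum>i=1..n. wn (T (u i)))"
    using s unfolding family_sums_def by blast
  have g0: "0 \<le> g" using u(2) by auto
  have g_le: "g \<le> a + b" using fragment_le [OF gab g0] ab by simp
  have "\<exists>x y. u i = x + y \<and> vn x = inf (vn (u i)) a \<and> vn y = inf (vn (u i)) b \<and>
      disjoint_vec vn x y" if "i \<in> {1..n}" for i
  proof -
    have "vn (u i) \<le> a + b"
      using vn_le_family_sum [OF that, of u] u(2) g_le by simp
    note split = disjoint_split [OF vn_nonneg ab this]
    have "0 \<le> inf (vn (u i)) a" "0 \<le> inf (vn (u i)) b" using ab by simp_all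
    with split(1) decomposable obtain x y where
      "u i = x + y" "vn x = inf (vn (u i)) a" "vn y = inf (vn (u i)) b"
      unfolding decomposable_def by blast
    then show ?thesis using split(2) by (metis disjoint_vec_iff)
  qed
  then obtain x y where xy: "\<And>i. i \<in> {1..n} \<Longrightarrow> u i = x i + y i"
      "\<And>i. i \<in> {1..n} \<Longrightarrow> vn (x i) = inf (vn (u i)) a"
      "\<And>i. i \<in> {1..n} \<Longrightarrow> vn (y i) = inf (vn (u i)) b"
      "\<And>i. i \<in> {1..n} \<Longrightarrow> disjoint_vec vn (x i) (y i)"
    by metis
  have split: "vn (u i) = vn (x i) + vn (y i)" if "i \<in> {1..n}" for i
  proof -
    have "vn (u i) \<le> a + b"
      using vn_le_family_sum [OF that, of u] u(2) g_le by simp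
    from disjoint_split(1) [OF vn_nonneg ab this] show ?thesis using xy that by simp
  qed
  have md: "mutually_disjoint vn n z" if z: "\<And>i. i \<in> {1..n} \<Longrightarrow> vn (z i) \<le> vn (u i)" for z
    unfolding mutually_disjoint_def
  proof (rule pairwiseI)
    fix i j assume ij: "i \<in> {1..n}" "j \<in> {1..n}" "i \<noteq> j"
    then have "disjoint_el (vn (u i)) (vn (u j))"
      using u(1) by (simp add: mutually_disjoint_def pairwise_def disjoint_vec_iff)
    then show "disjoint_vec vn (z i) (z j)"
      unfolding disjoint_vec_iff
      by (rule disjoint_el_mono_nonneg [OF _ vn_nonneg z [OF ij(1)] vn_nonneg z [OF ij(2)]])
  qed
  define g1 g2 where "g1 = (\<Sum>i=1..n. vn (x i))" and "g2 = (\<Sum>i=1..n. vn (y i))"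
  have g: "g = g1 + g2"
    unfolding g1_def g2_def u(2) [symmetric] sum.distrib [symmetric]
    by (intro sum.cong refl split)
  have nn: "0 \<le> g1" "0 \<le> g2" by (simp_all add: g1_def g2_def)
  have g1b: "disjoint_el b g1" unfolding g1_def
    using xy(2) ab by (intro disjoint_el_sum disjoint_el_sym [OF disjoint_el_mono [OF ab(3)]]) auto
  have g2a: "disjoint_el a g2" unfolding g2_def
    using xy(3) ab
    by (intro disjoint_el_sum disjoint_el_sym [OF disjoint_el_mono [OF disjoint_el_sym [OF ab(3)]]]) auto
  have g12: "disjoint_el g1 g2"
    unfolding g2_def
  proof (rule disjoint_el_sum)
    fix i assume "i \<in> {1..n}"
    then have "\<bar>vn (y i)\<bar> \<le> \<bar>b\<bar>" using xy(3) ab by simp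
    then show "disjoint_el g1 (vn (y i))"
      using g1b by (meson disjoint_el_mono disjoint_el_sym)
  qed
  have rest: "disjoint_el g1 (a + b - g)" "disjoint_el g2 (a + b - g)"
    using gab nn unfolding fragment_def g
    by (auto intro: disjoint_el_mono [of "g1 + g2"] simp: add_increasing add_increasing2)
  \<comment> \<open>The remainder \<open>a - g1\<close> equals \<open>(a + b - g) + g2 - b\<close>, and \<open>g1\<close> is disjoint from each of these
    three terms; the remainder of \<open>g2\<close> in \<open>b\<close> is treated symmetrically.\<close>
  have "fragment g1 a"
  proof -
    have "disjoint_el g1 ((a + b - g) + g2 - b)"
      by (intro disjoint_el_diff disjoint_el_add rest g12 disjoint_el_sym [OF g1b])
    then show ?thesis by (simp add: fragment_def g algebra_simps)
  qed
  moreover have "fragment g2 b"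
  proof -
    have "disjoint_el g2 ((a + b - g) + g1 - a)"
      by (intro disjoint_el_diff disjoint_el_add rest disjoint_el_sym [OF g12]
          disjoint_el_sym [OF g2a])
    then show ?thesis by (simp add: fragment_def g algebra_simps)
  qed
  moreover have "(\<Sum>i=1..n. wn (T (x i))) \<in> family_sums g1"
    using md [of x] xy(2) unfolding g1_def by (intro family_sumsI) auto
  moreover have "(\<Sum>i=1..n. wn (T (y i))) \<in> family_sums g2"
    using md [of y] xy(3) unfolding g2_def by (intro family_sumsI) auto
  moreover have "s \<le> (\<Sum>i=1..n. wn (T (x i))) + (\<Sum>i=1..n. wn (T (y i)))"
    unfolding u(3) sum.distrib [symmetric]
  proof (rule sum_mono)
    fix i assume i: "i \<in> {1..n}"
    have "T (u i) = T (x i) + T (y i)"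
      using dominated xy(1,4) [OF i]
      by (simp add: dominated_uryson_def orth_additive_vec_def)
    then show "wn (T (u i)) \<le> wn (T (x i)) + wn (T (y i))" by (simp add: wn_triangle)
  qed
  ultimately show thesis using g that by blast
qed

text \<open>Splitting any family over \<open>e = g + (e - g)\<close> leaves one over exactly \<open>e - g\<close>, which can be
  appended to the given family over \<open>g\<close>.\<close>

lemma family_sums_extend:
  assumes "s \<in> family_sums g" "fragment g e" "e \<in> E_tilde_pos vn"
  obtains s' where "s' \<in> family_sums e" "s \<le> s'"
proof -
  have nn: "0 \<le> g" "0 \<le> e"
    using family_sums_base_nonneg [OF assms(1)] assms(3) by (simp_all add: E_tilde_pos_def)
  have ge: "g \<le> e" using assms(2) nn by (rule fragment_le)
  have dis: "disjoint_el g (e - g)" using assms(2) by (simp add: fragment_def)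
  obtain r where "r \<in> family_sums (g + (e - g))"
    using family_sums_nonempty [OF assms(3)] by auto
  moreover have diff0: "0 \<le> e - g" using ge by simp
  ultimately obtain g1 g2 s1 s2 where f: "fragment g1 g" "fragment g2 (e - g)"
      "g + (e - g) = g1 + g2" "s1 \<in> family_sums g1" "s2 \<in> family_sums g2"
    by (rule family_sums_split [OF _ fragment_refl nn(1) _ dis])
  have "g1 \<le> g" by (rule fragment_le [OF f(1) family_sums_base_nonneg [OF f(4)] nn(1)])
  moreover have "g2 \<le> e - g"
    by (rule fragment_le [OF f(2) family_sums_base_nonneg [OF f(5)] diff0])
  moreover have "e - g = (g1 - g) + g2" using f(3) by (simp add: algebra_simps)
  \<comment> \<open>Two elements below \<open>g\<close> and \<open>e - g\<close> whose sum is still \<open>e\<close> must equal them.\<close>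
  ultimately have g2: "g2 = e - g"
    by (metis add_le_same_cancel2 diff_le_0_iff_le order_antisym)
  have "s + s2 \<in> family_sums (g + (e - g))"
    using family_sums_add [OF assms(1) f(5)] dis unfolding g2 by blast
  then show thesis
    using that [of "s + s2"] family_sums_nonneg [OF f(5)] by simp
qed

lemma family_sums_le_dominant:
  assumes "dominant vn wn T S" "s \<in> family_sums g"
  shows "s \<le> S g"
proof -
  have S: "orth_additive S" "\<And>v. wn (T v) \<le> S (vn v)"
    using assms(1) by (simp_all add: dominant_def uryson_pos_even_def abstract_uryson_def)
  have "(\<Sum>i=1..n. wn (T (u i))) \<le> S (\<Sum>i=1..n. vn (u i))" if "mutually_disjoint vn n u" for n u
    using that
  proof (induction n)
    case 0
    then show ?case using orth_additive_zero [OF S(1)] by simp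
  next
    case (Suc n)
    then have "disjoint_el (vn (u (Suc n))) (\<Sum>i=1..n. vn (u i))"
      by (intro disjoint_el_sum) (simp add: mutually_disjoint_Suc disjoint_vec_iff)
    then have "S ((\<Sum>i=1..n. vn (u i)) + vn (u (Suc n))) =
        S (\<Sum>i=1..n. vn (u i)) + S (vn (u (Suc n)))"
      using S(1) by (simp add: orth_additive_def disjoint_el_sym)
    then show ?case
      using Suc S(2) [of "u (Suc n)"] by (simp add: mutually_disjoint_Suc add_mono)
  qed
  then show ?thesis using assms(2) unfolding family_sums_def by blast
qed


section \<open>The supremum over fragments\<close>

definition fragment_sums :: "'e \<Rightarrow> 'f set" where
  "fragment_sums e = (\<Union>g \<in> {g. fragment g e}. family_sums g)"

definition fragment_sup :: "'e \<Rightarrow> 'f" where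
  "fragment_sup e = Sup (fragment_sums e)"

definition maximal_variation :: "'e \<Rightarrow> 'f" where
  "maximal_variation e = fragment_sup (sup e 0) + fragment_sup (sup (- e) 0)"

lemma zero_in_fragment_sums: "0 \<in> fragment_sums e"
  unfolding fragment_sums_def fragment_def using family_sums_zero by force

lemma family_sums_subset: "family_sums e \<subseteq> fragment_sums e"
  unfolding fragment_sums_def using fragment_refl by blast

lemma fragment_sums_le_dominant:
  assumes "dominant vn wn T S" "s \<in> fragment_sums e"
  shows "s \<le> S e"
proof -
  obtain g where g: "fragment g e" "s \<in> family_sums g"
    using assms(2) unfolding fragment_sums_def by blast
  have "s \<le> S g" using family_sums_le_dominant assms(1) g(2) .
  also have "\<dots> \<le> S e" using assms(1) g(1) by (simp add: dominant_def uryson_fragment_le)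
  finally show ?thesis .
qed

lemma fragment_sup_upper: "s \<in> fragment_sums e \<Longrightarrow> s \<le> fragment_sup e"
proof -
  assume s: "s \<in> fragment_sums e"
  obtain S where "dominant vn wn T S" using dominated by (auto simp: dominated_uryson_def)
  then have "bdd_above (fragment_sums e)" by (meson bdd_aboveI fragment_sums_le_dominant)
  with s show ?thesis unfolding fragment_sup_def by (rule cSup_upper)
qed

text \<open>The supremum is taken over a nonempty set, since the empty family sits over the fragment \<open>0\<close>.\<close>

lemma fragment_sup_least: "(\<And>s. s \<in> fragment_sums e \<Longrightarrow> s \<le> x) \<Longrightarrow> fragment_sup e \<le> x"
  unfolding fragment_sup_def using zero_in_fragment_sums by (auto intro: cSup_least)

lemma fragment_sup_nonneg: "0 \<le> fragment_sup e"
  by (rule fragment_sup_upper [OF zero_in_fragment_sums])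

lemma fragment_sup_le_dominant: "dominant vn wn T S \<Longrightarrow> fragment_sup e \<le> S e"
  by (rule fragment_sup_least) (rule fragment_sums_le_dominant)

text \<open>Splitting a family over a fragment of \<open>a + b\<close> gives one inequality, concatenating families over
  fragments of \<open>a\<close> and of \<open>b\<close> the other.\<close>

lemma fragment_sup_add:
  assumes ab: "0 \<le> a" "0 \<le> b" "disjoint_el a b"
  shows "fragment_sup (a + b) = fragment_sup a + fragment_sup b"
proof (rule antisym)
  show "fragment_sup (a + b) \<le> fragment_sup a + fragment_sup b"
  proof (rule fragment_sup_least)
    fix s assume "s \<in> fragment_sums (a + b)"
    then obtain g where "s \<in> family_sums g" "fragment g (a + b)"
      unfolding fragment_sums_def by blast
    from family_sums_split [OF this ab] obtain g1 g2 s1 s2 where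
      f: "fragment g1 a" "fragment g2 b" "s1 \<in> family_sums g1" "s2 \<in> family_sums g2" "s \<le> s1 + s2"
      by metis
    then have "s1 \<le> fragment_sup a" "s2 \<le> fragment_sup b"
      by (auto intro!: fragment_sup_upper simp: fragment_sums_def)
    then show "s \<le> fragment_sup a + fragment_sup b"
      using f(5) add_mono order_trans by blast
  qed
next
  have sum_le: "s + t \<le> fragment_sup (a + b)"
    if st: "s \<in> fragment_sums a" "t \<in> fragment_sums b" for s t
  proof -
    obtain g h where gh: "fragment g a" "s \<in> family_sums g" "fragment h b" "t \<in> family_sums h"
      using st unfolding fragment_sums_def by blast
    have nn: "0 \<le> g" "0 \<le> h" using gh family_sums_base_nonneg by blast+
    have "g \<le> a" "h \<le> b" using gh nn ab by (auto intro: fragment_le)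
    then have "disjoint_el g h"
      by (rule disjoint_el_mono_nonneg [OF ab(3) nn(1) _ nn(2)])
    then have "s + t \<in> family_sums (g + h)" using gh by (intro family_sums_add)
    moreover have "fragment (g + h) (a + b)" using gh nn ab by (intro fragment_add)
    ultimately show ?thesis
      by (auto intro!: fragment_sup_upper simp: fragment_sums_def)
  qed
  have "fragment_sup b \<le> fragment_sup (a + b) - s" if "s \<in> fragment_sums a" for s
    using sum_le [OF that] by (intro fragment_sup_least) (simp add: le_diff_eq add.commute [of _ s])
  then have "fragment_sup a \<le> fragment_sup (a + b) - fragment_sup b"
    by (intro fragment_sup_least) (simp add: le_diff_eq add.commute)
  then show "fragment_sup a + fragment_sup b \<le> fragment_sup (a + b)"
    by (simp add: le_diff_eq)
qed

lemma fragment_sup_zero: "fragment_sup 0 = 0"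
  using fragment_sup_add [of 0 0] by simp

lemma maximal_variation_nonneg_arg: "0 \<le> e \<Longrightarrow> maximal_variation e = fragment_sup e"
  by (simp add: maximal_variation_def sup_absorb1 sup_absorb2 fragment_sup_zero)

lemma maximal_variation_le_dominant:
  assumes "dominant vn wn T S"
  shows "maximal_variation e \<le> S e"
proof -
  have "S \<in> uryson_pos_even" using assms by (simp add: dominant_def)
  from uryson_pos_neg [OF this, of e] show ?thesis
    unfolding maximal_variation_def by (simp add: add_mono fragment_sup_le_dominant [OF assms])
qed

lemma maximal_variation_nonneg: "0 \<le> maximal_variation e"
  by (simp add: maximal_variation_def fragment_sup_nonneg)

text \<open>Orthogonal additivity reduces to the positive cone because positive and negative parts are
  additive on disjoint elements; order bounds are inherited from any dominant.\<close>

lemma maximal_variation_uryson: "maximal_variation \<in> uryson_pos_even"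
proof -
  obtain S where S: "dominant vn wn T S" using dominated by (auto simp: dominated_uryson_def)
  have "orth_additive maximal_variation"
    unfolding orth_additive_def
  proof (intro allI impI)
    fix x y :: 'e assume xy: "disjoint_el x y"
    then have mxy: "disjoint_el (- x) (- y)"
      by (metis disjoint_el_minus disjoint_el_sym)
    have neg: "sup (- (x + y)) 0 = sup (- x) 0 + sup (- y) 0"
      using pos_add_disjoint(1) [OF mxy] by simp
    then show "maximal_variation (x + y) = maximal_variation x + maximal_variation y"
      unfolding maximal_variation_def pos_add_disjoint(1) [OF xy] neg
      using fragment_sup_add [OF _ _ pos_add_disjoint(2) [OF xy]]
        fragment_sup_add [OF _ _ pos_add_disjoint(2) [OF mxy]]
      by simp
  qed
  moreover have "order_bounded_map maximal_variation"
    unfolding order_bounded_map_def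
  proof (intro allI impI)
    fix A :: "'e set" assume "order_bounded A"
    then have "order_bounded (S ` A)"
      using S by (simp add: dominant_def uryson_pos_even_def abstract_uryson_def order_bounded_map_def)
    then obtain c d where "S ` A \<subseteq> {c..d}" unfolding order_bounded_def by auto
    then have "S e \<le> d" if "e \<in> A" for e using that by auto
    then have "maximal_variation ` A \<subseteq> {0..d}"
      using order_trans [OF maximal_variation_le_dominant [OF S]]
      by (intro image_subsetI) (simp add: maximal_variation_nonneg)
    then show "order_bounded (maximal_variation ` A)" unfolding order_bounded_def by blast
  qed
  ultimately show ?thesis
    by (simp add: uryson_pos_even_def abstract_uryson_def positive_map_def even_map_def
        maximal_variation_nonneg) (simp add: maximal_variation_def add.commute)
qed

section \<open>The exact dominant and its formulas\<close>

lemma is_exact_dominant_maximal_variation: "is_exact_dominant vn wn T maximal_variation"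
proof -
  have "wn (T v) \<le> maximal_variation (vn v)" for v
  proof -
    have "wn (T v) \<in> fragment_sums (vn v)"
      using family_sums_norm family_sums_subset by blast
    then show ?thesis by (simp add: maximal_variation_nonneg_arg fragment_sup_upper)
  qed
  then show ?thesis
    by (simp add: is_exact_dominant_def dominant_def uryson_le_def positive_map_def
        maximal_variation_uryson maximal_variation_le_dominant)
qed

lemma exact_dominant_eq: "exact_dominant vn wn T = maximal_variation"
  unfolding exact_dominant_def
proof (rule the_equality, rule is_exact_dominant_maximal_variation)
  fix S assume S: "is_exact_dominant vn wn T S"
  then have "S e \<le> maximal_variation e" "maximal_variation e \<le> S e" for e
    using is_exact_dominant_maximal_variation
    by (auto simp: is_exact_dominant_def uryson_le_def positive_map_def)
  then show "S = maximal_variation" by (auto intro: antisym)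
qed

text \<open>The supremum defining \<open>maximal_variation e\<close> also runs over families over proper fragments of
  \<open>e\<close>; each of these extends to a family over \<open>e\<close> with a larger sum.\<close>

lemma isLub_family_sums:
  assumes "e \<in> E_tilde_pos vn"
  shows "isLub UNIV (family_sums e) (maximal_variation e)"
proof (rule isLubI2)
  have e: "maximal_variation e = fragment_sup e"
    using assms by (simp add: maximal_variation_nonneg_arg E_tilde_pos_def)
  show "isUb UNIV (family_sums e) (maximal_variation e)"
    unfolding e by (auto intro!: isUbI setleI fragment_sup_upper dest: subsetD [OF family_sums_subset])
  show "maximal_variation e <=* Collect (isUb UNIV (family_sums e))"
    unfolding e
  proof (intro setgeI ballI fragment_sup_least)
    fix x s assume x: "x \<in> Collect (isUb UNIV (family_sums e))" and "s \<in> fragment_sums e"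
    then obtain s' where "s' \<in> family_sums e" "s \<le> s'"
      unfolding fragment_sums_def using family_sums_extend assms by blast
    then show "s \<le> x" using x by (auto dest!: isUbD2 intro: order_trans simp: isUb_def setle_def)
  qed
qed

text \<open>A sum over a family with norm sum \<open>g\<close> is at most the value at \<open>g\<close>, and this value belongs to
  the set in question.\<close>

lemma isLub_fragments:
  assumes "0 \<le> e"
  shows "isLub UNIV {maximal_variation g | g. g \<in> E_tilde_pos vn \<and> fragment g e}
    (maximal_variation e)"
    (is "isLub UNIV ?A _")
proof (rule isLubI2)
  show "isUb UNIV ?A (maximal_variation e)"
    using uryson_fragment_le [OF maximal_variation_uryson] by (auto intro!: isUbI setleI)
  show "maximal_variation e <=* Collect (isUb UNIV ?A)"
    unfolding maximal_variation_nonneg_arg [OF assms]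
  proof (intro setgeI ballI fragment_sup_least)
    fix x s assume x: "x \<in> Collect (isUb UNIV ?A)" and "s \<in> fragment_sums e"
    then obtain g where g: "fragment g e" "s \<in> family_sums g"
      unfolding fragment_sums_def by blast
    have "s \<le> maximal_variation g"
      using g(2) family_sums_le_dominant is_exact_dominant_maximal_variation
      unfolding is_exact_dominant_def by blast
    also have "\<dots> \<le> x"
      using x g family_sums_E_tilde unfolding isUb_def setle_def by blast
    finally show "s \<le> x" .
  qed
qed

end

theorem theorem4p6:
  fixes vn :: "'v::real_vector \<Rightarrow> 'e::archimedean_vector_lattice"
    and wn :: "'w::real_vector \<Rightarrow> 'f::{archimedean_vector_lattice, conditionally_complete_lattice}"
    and T :: "'v \<Rightarrow> 'w"
  assumes "lattice_normed_space vn"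
    and "lattice_normed_space wn"
    and "decomposable vn"
    and "dominated_uryson vn wn T"
  shows "is_exact_dominant vn wn T (exact_dominant vn wn T) \<and>
    (\<forall>e \<in> E_tilde_pos vn.
       isLub UNIV
         {(\<Sum>i=1..n. wn (T (u i))) | n u.
            mutually_disjoint vn n u \<and> (\<Sum>i=1..n. vn (u i)) = e}
         (exact_dominant vn wn T e)) \<and>
    (\<forall>e. 0 \<le> e \<longrightarrow>
       isLub UNIV
         {exact_dominant vn wn T e0 | e0. e0 \<in> E_tilde_pos vn \<and> fragment e0 e}
         (exact_dominant vn wn T e)) \<and>
    (\<forall>e. exact_dominant vn wn T e =
       exact_dominant vn wn T (sup e 0) + exact_dominant vn wn T (sup (- e) 0))"
proof -
  interpret dominated_operator vn wn T by (rule dominated_operator.intro) (fact assms)+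
  have "maximal_variation e = maximal_variation (sup e 0) + maximal_variation (sup (- e) 0)" for e
    by (rule uryson_pos_neg [OF maximal_variation_uryson])
  then show ?thesis
    unfolding exact_dominant_eq
    using is_exact_dominant_maximal_variation isLub_family_sums [unfolded family_sums_def]
      isLub_fragments
    by blast
qed

end
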